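(* Let $\phi:\mathbb{R}^n\to\mathbb{R}^n$ be a global $C^\infty$-diffeomorphism with Jacobian determinant of absolute value $|J_\phi(x)|=|\det D\phi(x)|\neq 0$ for all $x$, and let $\omega\in C^\infty(\mathbb{R}^n;\mathbb{C})$ be nowhere vanishing. Then for every $f\in\mathcal{S}_{\phi,\omega}(\mathbb{R}^n)$ and every $x\in\mathbb{R}^n$, $$f(x)=\frac{1}{\omega(x)(2\pi)^{n/2}}\int_{\mathbb{R}^n}e^{i\xi\cdot\phi(x)}\,[\mathcal{F}_{\phi,\omega}f](\xi)\,d\xi .$$
   Context: The generalized Schwartz space is $\mathcal{S}_{\phi,\omega}(\mathbb{R}^n)=\{f:\mathbb{R}^n\to\mathbb{C}\mid (\omega f)\circ\phi^{-1}\in\mathcal{S}(\mathbb{R}^n)\}$, where $\mathcal{S}(\mathbb{R}^n)$ is the classical Schwartz space. The weighted Fourier transform is $$[\mathcal{F}_{\phi,\omega}f](\xi)=\frac{1}{(2\pi)^{n/2}}\int_{\mathbb{R}^n}e^{-i\xi\cdot\phi(x)}\,\omega(x)f(x)\,|J_\phi(x)|\,dx .$$ *)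

theory Defs
  imports "HOL-Analysis.Analysis"
begin

text \<open>
  \<open>C\<^sup>k\<close> maps on a finite-dimensional space: testing all directional derivatives
  \<open>x \<mapsto> Df(x) v\<close> for fixed \<open>v\<close> amounts to testing the derivative map itself, because the
  domain is finite-dimensional.  This formulation keeps the codomain fixed in the recursion.
\<close>

primrec Ck :: "nat \<Rightarrow> ('a::euclidean_space \<Rightarrow> 'b::real_normed_vector) \<Rightarrow> bool" where
  "Ck 0 f \<longleftrightarrow> continuous_on UNIV f"
| "Ck (Suc k) f \<longleftrightarrow>
     (\<forall>x. f differentiable (at x)) \<and> (\<forall>v. Ck k (\<lambda>x. frechet_derivative f (at x) v))"

definition smooth :: "('a::euclidean_space \<Rightarrow> 'b::real_normed_vector) \<Rightarrow> bool" where
  "smooth f \<longleftrightarrow> (\<forall>k. Ck k f)"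

definition smooth_diffeo :: "('a::euclidean_space \<Rightarrow> 'a) \<Rightarrow> bool" where
  "smooth_diffeo \<phi> \<longleftrightarrow> bij \<phi> \<and> smooth \<phi> \<and> smooth (inv \<phi>)"

definition jacobian_det :: "(real ^ 'n \<Rightarrow> real ^ 'n) \<Rightarrow> real ^ 'n \<Rightarrow> real" where
  "jacobian_det \<phi> x = det (jacobian \<phi> (at x))"

definition partial_deriv :: "'n \<Rightarrow> (real ^ 'n \<Rightarrow> complex) \<Rightarrow> (real ^ 'n \<Rightarrow> complex)" where
  "partial_deriv i f = (\<lambda>x. frechet_derivative f (at x) (axis i 1))"

text \<open>
  Higher partial derivatives are indexed by lists of coordinates.  The derivative
  \<open>\<partial>\<^sup>\<beta>\<close> of a smooth function for a multi-index \<open>\<beta>\<close> is obtained from any list containing each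
  coordinate \<open>i\<close> exactly \<open>\<beta> i\<close> times, and every list arises from such a multi-index.
\<close>

primrec iter_partial :: "'n list \<Rightarrow> (real ^ 'n \<Rightarrow> complex) \<Rightarrow> (real ^ 'n \<Rightarrow> complex)" where
  "iter_partial [] f = f"
| "iter_partial (i # is) f = partial_deriv i (iter_partial is f)"

definition monomial :: "('n \<Rightarrow> nat) \<Rightarrow> real ^ 'n \<Rightarrow> real" where
  "monomial \<alpha> x = (\<Prod>i\<in>UNIV. (x $ i) ^ \<alpha> i)"

definition schwartz_space :: "(real ^ 'n \<Rightarrow> complex) set" where
  "schwartz_space =
     {f. smooth f \<and>
         (\<forall>\<alpha> is. bounded (range (\<lambda>x. complex_of_real (monomial \<alpha> x) * iter_partial is f x)))}"

definition weighted_schwartz_space ::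
    "(real ^ 'n \<Rightarrow> real ^ 'n) \<Rightarrow> (real ^ 'n \<Rightarrow> complex) \<Rightarrow> (real ^ 'n \<Rightarrow> complex) set" where
  "weighted_schwartz_space \<phi> \<omega> = {f. (\<lambda>x. \<omega> x * f x) \<circ> inv \<phi> \<in> schwartz_space}"

definition weighted_fourier ::
    "(real ^ 'n \<Rightarrow> real ^ 'n) \<Rightarrow> (real ^ 'n \<Rightarrow> complex) \<Rightarrow> (real ^ 'n \<Rightarrow> complex) \<Rightarrow>
     (real ^ 'n \<Rightarrow> complex)" where
  "weighted_fourier \<phi> \<omega> f \<xi> =
     1 / complex_of_real ((2 * pi) powr (real CARD('n) / 2)) *
     (LINT x|lborel. exp (- (\<i> * complex_of_real (\<xi> \<bullet> \<phi> x))) * \<omega> x * f x *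
        complex_of_real \<bar>jacobian_det \<phi> x\<bar>)"

end

theory Submission
  imports Defs "HOL-Probability.Characteristic_Functions" "HOL-Probability.Sinc_Integral"
begin

text \<open>
  With \<open>g = (\<omega> f) \<circ> \<phi>\<^sup>-\<^sup>1\<close>, the substitution \<open>y = \<phi> x\<close> turns the weighted transform of \<open>f\<close> into
  the classical transform of the Schwartz function \<open>g\<close>, so the claim is Fourier inversion for
  \<open>g\<close> at \<open>\<phi> x\<close>.  Inversion is proved by inserting the factor \<open>exp (- \<epsilon>\<^sup>2 \<bar>\<xi>\<bar>\<^sup>2 / 2)\<close>: by Fubini
  the regularised integral is a multiple of the Gaussian mean of \<open>z \<mapsto> g (y + \<epsilon> z)\<close>, and dominated
  convergence applies to both sides as \<open>\<epsilon> \<rightarrow> 0\<close>.  Domination on the transform side needs the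
  transform of \<open>g\<close> to be integrable, which follows from the rule that the
  transform of \<open>\<partial>\<^sub>i g\<close> is \<open>\<i> \<xi>\<^sub>i\<close> times that of \<open>g\<close>.
\<close>

subsection \<open>Gaussian integrals on Cartesian space\<close>

lemma Basis_cart: "(Basis :: (real^'n) set) = range (\<lambda>i. axis i 1)"
  by (auto simp: Basis_vec_def)

lemma inj_axis_1: "inj (\<lambda>i::'n::finite. axis i (1::real))"
  by (auto simp: inj_def axis_eq_axis)

lemma prod_Basis_cart:
  fixes g :: "real^'n \<Rightarrow> 'b::comm_monoid_mult"
  shows "(\<Prod>b\<in>Basis. g b) = (\<Prod>i\<in>UNIV. g (axis i 1))"
  unfolding Basis_cart by (subst prod.reindex[OF inj_axis_1]) simp

text \<open>\<open>lborel_eq\<close> presents Lebesgue measure as the image of a product measure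
  indexed by \<open>Basis\<close>, where integrals of products split. The map \<open>ix\<close>
  translates basis vectors back into coordinates.\<close>

lemma lborel_cart_prod:
  fixes f :: "'n::finite \<Rightarrow> real \<Rightarrow> 'b::{real_normed_field,banach,second_countable_topology}"
  assumes int: "\<And>i. integrable lborel (f i)"
  shows integrable_lborel_cart_prod: "integrable lborel (\<lambda>x::real^'n. \<Prod>i\<in>UNIV. f i (x $ i))"
    and integral_lborel_cart_prod:
      "(LINT x|lborel. (\<Prod>i\<in>UNIV. f i ((x::real^'n) $ i))) = (\<Prod>i\<in>UNIV. LINT t|lborel. f i t)"
proof -
  interpret product_sigma_finite "\<lambda>_::real^'n. lborel :: real measure"
    by standard
  define ix :: "real^'n \<Rightarrow> 'n" where "ix = inv (\<lambda>i. axis i 1)"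
  have ix: "ix (axis i 1) = i" for i
    unfolding ix_def by (rule inv_f_f[OF inj_axis_1])
  have meas [measurable]: "f i \<in> borel_measurable borel" for i
    using int[of i] by auto
  let ?S = "\<lambda>h::real^'n \<Rightarrow> real. \<Sum>b\<in>Basis. h b *\<^sub>R b"
  have S: "?S \<in> (\<Pi>\<^sub>M b\<in>Basis. lborel) \<rightarrow>\<^sub>M borel"
    by measurable
  have comp: "?S h $ i = h (axis i 1)" for h i
  proof -
    have "?S h $ i = ?S h \<bullet> axis i 1"
      by (simp add: inner_axis)
    also have "\<dots> = h (axis i 1)"
      by (rule inner_sum_left_Basis) (auto simp: Basis_cart)
    finally show ?thesis .
  qed
  have eq: "(\<Prod>i\<in>UNIV. f i (?S h $ i)) = (\<Prod>b\<in>Basis. f (ix b) (h b))" for h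
    unfolding comp by (simp add: prod_Basis_cart ix)
  have lb: "(lborel :: (real^'n) measure) = distr (\<Pi>\<^sub>M b\<in>Basis. lborel) borel ?S"
    by (rule lborel_eq)
  have meas': "(\<lambda>x::real^'n. \<Prod>i\<in>UNIV. f i (x $ i)) \<in> borel_measurable borel"
    by measurable
  have "integrable (\<Pi>\<^sub>M b\<in>Basis. lborel) (\<lambda>h. \<Prod>b\<in>(Basis::(real^'n) set). f (ix b) (h b))"
    by (rule product_integrable_prod) (auto intro: int)
  then show "integrable lborel (\<lambda>x::real^'n. \<Prod>i\<in>UNIV. f i (x $ i))"
    unfolding lb integrable_distr_eq[OF S meas'] eq .
  have "(LINT x|lborel. (\<Prod>i\<in>UNIV. f i ((x::real^'n) $ i))) = (\<Prod>b\<in>(Basis::(real^'n) set). LINT t|lborel. f (ix b) t)"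
    unfolding lb integral_distr[OF S meas'] eq
    by (rule product_integral_prod) (auto intro: int)
  also have "\<dots> = (\<Prod>i\<in>UNIV. LINT t|lborel. f i t)"
    by (simp add: prod_Basis_cart ix)
  finally show "(LINT x|lborel. (\<Prod>i\<in>UNIV. f i ((x::real^'n) $ i))) = (\<Prod>i\<in>UNIV. LINT t|lborel. f i t)" .
qed

lemma lborel_integral_affine:
  fixes f :: "'a::euclidean_space \<Rightarrow> 'b::{banach, second_countable_topology}"
  assumes "c \<noteq> 0" and [measurable]: "f \<in> borel_measurable borel"
  shows "(LINT x|lborel. f x) = \<bar>c\<bar> ^ DIM('a) *\<^sub>R (LINT x|lborel. f (t + c *\<^sub>R x))"
  by (subst lborel_affine[OF assms(1), of t]) (simp add: integral_density integral_distr)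

lemma lborel_integral_translate:
  fixes f :: "'a::euclidean_space \<Rightarrow> 'b::{banach, second_countable_topology}"
  assumes [measurable]: "f \<in> borel_measurable borel"
  shows "(LINT x|lborel. f (x + t)) = (LINT x|lborel. f x)"
  using lborel_integral_affine[of 1 f t] by (simp add: add.commute)

lemma lborel_integrable_translate:
  fixes f :: "'a::euclidean_space \<Rightarrow> 'b::{banach, second_countable_topology}"
  assumes "integrable lborel f"
  shows "integrable lborel (\<lambda>x. f (x + t))"
proof -
  have "integrable (distr lborel borel ((+) t)) f"
    by (simp add: lborel_distr_plus assms)
  then show ?thesis
    using assms by (subst (asm) integrable_distr_eq) (auto simp: add.commute)
qed

text \<open>Up to the factor \<open>sqrt (2 * pi)\<close> of the density, this is the characteristic
  function of the standard normal distribution.\<close>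

lemma gaussian_integral_1:
  fixes s :: real
  shows "integrable lborel (\<lambda>t::real. exp (\<i> * complex_of_real (s * t)) * complex_of_real (exp (- (t\<^sup>2 / 2))))"
    and "(LINT t|lborel. exp (\<i> * complex_of_real (s * t)) * complex_of_real (exp (- (t\<^sup>2 / 2)))) =
      complex_of_real (sqrt (2 * pi) * exp (- (s\<^sup>2 / 2)))"
proof -
  have int: "integrable lborel (\<lambda>t::real. exp (- (t\<^sup>2 / 2)))"
  proof -
    have "integrable lborel (\<lambda>t. sqrt (2 * pi) * std_normal_density t)"
      using integrable_normal_density[of 1 0] by (intro integrable_mult_right) auto
    then show ?thesis
      by (simp add: std_normal_density_def)
  qed
  show "integrable lborel (\<lambda>t::real. exp (\<i> * complex_of_real (s * t)) * complex_of_real (exp (- (t\<^sup>2 / 2))))"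
    by (rule Bochner_Integration.integrable_bound[OF int]) (auto simp: norm_mult)
  have "char std_normal_distribution s = 
    (LINT t|lborel. complex_of_real (1 / sqrt (2 * pi)) * (exp (\<i> * complex_of_real (s * t)) * complex_of_real (exp (- (t\<^sup>2 / 2)))))"
    unfolding char_def
    by (subst integral_density) (auto simp: std_normal_density_def scaleR_conv_of_real ac_simps intro!: Bochner_Integration.integral_cong)
  then have "complex_of_real (exp (- (s\<^sup>2 / 2))) = complex_of_real (1 / sqrt (2 * pi)) * 
     (LINT t|lborel. (exp (\<i> * complex_of_real (s * t)) * complex_of_real (exp (- (t\<^sup>2 / 2)))))"
    by (simp add: char_std_normal_distribution)
  then show "(LINT t|lborel. exp (\<i> * complex_of_real (s * t)) * complex_of_real (exp (- (t\<^sup>2 / 2)))) =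
      complex_of_real (sqrt (2 * pi) * exp (- (s\<^sup>2 / 2)))"
    by (simp add: field_simps)
qed

text \<open>Scaled to have value 1 at the origin rather than total mass 1, so that
  \<open>gaussian (\<epsilon> *\<^sub>R \<xi>)\<close> tends to 1 as \<epsilon> tends to 0.\<close>

definition gaussian :: "'a::euclidean_space \<Rightarrow> real" where
  "gaussian x = exp (- ((norm x)\<^sup>2 / 2))"

lemma gaussian_continuous [continuous_intros]: "continuous_on S gaussian"
  unfolding gaussian_def by (intro continuous_intros) auto

lemma gaussian_measurable [measurable]: "gaussian \<in> borel_measurable borel"
  by (intro borel_measurable_continuous_onI gaussian_continuous)

lemma gaussian_bounds: "0 < gaussian x" "gaussian x \<le> 1"
  by (auto simp: gaussian_def)

lemma norm_cart_power2: "(norm (x::real^'n))\<^sup>2 = (\<Sum>i\<in>UNIV. (x $ i)\<^sup>2)"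
  by (simp add: norm_vec_def L2_set_def sum_nonneg)

lemma gaussian_transform_integrand:
  fixes s x :: "real^'n"
  shows "exp (\<i> * complex_of_real (s \<bullet> x)) * complex_of_real (gaussian x) =
    (\<Prod>i\<in>UNIV. exp (\<i> * complex_of_real (s $ i * x $ i)) * complex_of_real (exp (- ((x $ i)\<^sup>2 / 2))))"
  unfolding gaussian_def norm_cart_power2
  by (simp add: prod.distrib inner_vec_def exp_sum sum_distrib_left sum_divide_distrib flip: sum_negf of_real_exp)

text \<open>The integrand is a product of functions of single coordinates, so the one-dimensional
  transform is applied in each coordinate.\<close>

lemma gaussian_transform:
  fixes s :: "real^'n"
  shows "integrable lborel (\<lambda>x. exp (\<i> * complex_of_real (s \<bullet> x)) * complex_of_real (gaussian x))"
    and "(LINT x|lborel. exp (\<i> * complex_of_real (s \<bullet> x)) * complex_of_real (gaussian x)) =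
      complex_of_real (sqrt (2 * pi) ^ CARD('n) * gaussian s)"
proof -
  show "integrable lborel (\<lambda>x. exp (\<i> * complex_of_real (s \<bullet> x)) * complex_of_real (gaussian x))"
    unfolding gaussian_transform_integrand
    by (intro integrable_lborel_cart_prod[where f="\<lambda>i t. exp (\<i> * complex_of_real (s $ i * t)) * complex_of_real (exp (- (t\<^sup>2 / 2)))"] gaussian_integral_1)
  show "(LINT x|lborel. exp (\<i> * complex_of_real (s \<bullet> x)) * complex_of_real (gaussian x)) =
      complex_of_real (sqrt (2 * pi) ^ CARD('n) * gaussian s)"
    unfolding gaussian_transform_integrand
    apply (subst integral_lborel_cart_prod[where f="\<lambda>i t. exp (\<i> * complex_of_real (s $ i * t)) * complex_of_real (exp (- (t\<^sup>2 / 2)))"])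
     apply (rule gaussian_integral_1)
    unfolding gaussian_integral_1 gaussian_def norm_cart_power2
    by (simp add: prod.distrib exp_sum sum_divide_distrib flip: sum_negf)
qed

lemma gaussian_integrable: "integrable lborel (gaussian :: real^'n \<Rightarrow> real)"
  using integrable_norm[OF gaussian_transform(1)[of 0]]
  by (simp add: less_imp_le[OF gaussian_bounds(1)])

lemma gaussian_integral: "(LINT x|lborel. gaussian (x::real^'n)) = sqrt (2 * pi) ^ CARD('n)"
proof -
  have "complex_of_real (LINT x|lborel. gaussian (x::real^'n)) = complex_of_real (sqrt (2 * pi) ^ CARD('n))"
    using gaussian_transform(2)[of "0::real^'n"] by (simp add: gaussian_def flip: integral_complex_of_real)
  then show ?thesis
    unfolding of_real_eq_iff .
qed

subsection \<open>Change of variables\<close>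

lemma sign_conj_bij:
  fixes p :: "'m::finite \<Rightarrow> 'n::finite"
  assumes p: "bij p" and s: "s permutes UNIV"
  shows "sign (inv p \<circ> s \<circ> p) = sign s"
proof -
  have inv1: "p (inv p x) = x" for x
    using p by (simp add: bij_is_surj surj_f_inv_f)
  have inv2: "inv p (p x) = x" for x
    using p by (simp add: bij_is_inj)
  \<comment> \<open>The first conjunct is carried through the induction because
    \<open>sign_compose\<close> asks for it.\<close>
  have "permutation (inv p \<circ> s \<circ> p) \<and> sign (inv p \<circ> s \<circ> p) = sign s"
    using s finite_class.finite_UNIV
  proof (induction rule: permutes_induct)
    case id
    have "inv p \<circ> id \<circ> p = id" by (auto simp: inv2)
    then show ?case by simp
  next
    case (swap a b q)
    \<comment> \<open>Conjugation by \<open>p\<close> turns a transposition into the transposition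
      of the preimages, so each induction step changes both signs alike.\<close>
    have "inv p (Transposition.transpose a b z) = Transposition.transpose (inv p a) (inv p b) (inv p z)" for z
      using transpose_apply_commute[OF p, of a b "inv p z"] by (simp add: inv1 inv2)
    then have eq: "inv p \<circ> (Transposition.transpose a b \<circ> q) \<circ> p =
        Transposition.transpose (inv p a) (inv p b) \<circ> (inv p \<circ> q \<circ> p)"
      by (simp add: fun_eq_iff)
    have "inv p a = inv p b \<longleftrightarrow> a = b"
      by (metis inv1)
    moreover have "permutation q"
      using permutes_imp_permutation[OF finite_class.finite_UNIV swap(4)] .
    ultimately show ?case
      using swap.IH unfolding eq
      by (simp only: sign_compose permutation_swap_id permutation_compose sign_swap_id simp_thms)
  qed
  then show ?thesis ..
qed

text \<open>In the Leibniz formula, conjugation by \<open>p\<close> matches the permutations of the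
  two index types. It keeps signs by \<open>sign_conj_bij\<close> and only reorders the factors of
  each product.\<close>

lemma det_reindex:
  fixes A :: "'a::comm_ring_1 ^ 'n ^ 'n" and p :: "'m::finite \<Rightarrow> 'n"
  assumes p: "bij p"
  shows "det (\<chi> a b. A $ p a $ p b) = det A"
proof -
  have inv1: "p (inv p x) = x" for x
    using p by (simp add: bij_is_surj surj_f_inv_f)
  have inv2: "inv p (p x) = x" for x
    using p by (simp add: bij_is_inj)
  have perm: "s permutes UNIV \<longleftrightarrow> bij s" for s :: "'b \<Rightarrow> 'b"
    by (simp add: permutes_def bij_iff)
  have prod: "(\<Prod>a\<in>UNIV. A $ p a $ s (p a)) = (\<Prod>i\<in>UNIV. A $ i $ s i)" for s
    using prod.reindex_bij_betw[OF p, of "\<lambda>i. A $ i $ s i"] by simp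
  show ?thesis
    unfolding det_def
  proof (rule sum.reindex_bij_witness[where i="\<lambda>s. inv p \<circ> s \<circ> p" and j="\<lambda>t. p \<circ> t \<circ> inv p"])
    fix t :: "'m \<Rightarrow> 'm" assume "t \<in> {t. t permutes UNIV}"
    then have t: "bij t" by (simp add: perm)
    show "inv p \<circ> (p \<circ> t \<circ> inv p) \<circ> p = t"
      by (auto simp: inv2)
    show *: "p \<circ> t \<circ> inv p \<in> {s. s permutes UNIV}"
      using p t by (simp add: perm bij_comp bij_imp_bij_inv)
    have "sign t = sign (inv p \<circ> (p \<circ> t \<circ> inv p) \<circ> p)"
      by (rule arg_cong[where f=sign]) (auto simp: inv2)
    also have "\<dots> = sign (p \<circ> t \<circ> inv p)"
      using * by (intro sign_conj_bij p) simp
    finally show "of_int (sign (p \<circ> t \<circ> inv p)) * (\<Prod>i\<in>UNIV. A $ i $ (p \<circ> t \<circ> inv p) i) =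
        of_int (sign t) * (\<Prod>i\<in>UNIV. (\<chi> a b. A $ p a $ p b) $ i $ t i)"
      by (simp add: inv2 flip: prod)
  next
    fix s :: "'n \<Rightarrow> 'n" assume "s \<in> {s. s permutes UNIV}"
    then have s: "bij s" by (simp add: perm)
    show "p \<circ> (inv p \<circ> s \<circ> p) \<circ> inv p = s"
      by (auto simp: inv1)
    show "inv p \<circ> s \<circ> p \<in> {t. t permutes UNIV}"
      using p s by (simp add: perm bij_comp bij_imp_bij_inv)
  qed
qed

text \<open>Lebesgue measure is determined by its values on boxes. The preimage of a box is open and
  \<open>g\<close> maps it injectively onto the box, so
  \<open>has_measure_differentiable_image\<close> equates the volume of the box with the integral of
  the Jacobian over the preimage.\<close>

lemma distr_density_det_wellorder:
  fixes g :: "real^'m::{finite,wellorder} \<Rightarrow> real^'m::_"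
  assumes der: "\<And>x. (g has_derivative g' x) (at x)"
    and bij: "bij g"
    and meas: "(\<lambda>x. \<bar>det (matrix (g' x))\<bar>) \<in> borel_measurable borel"
  shows "distr (density lborel (\<lambda>x. ennreal \<bar>det (matrix (g' x))\<bar>)) borel g = lborel"
proof (rule lborel_eqI[symmetric])
  have cont: "continuous_on UNIV g"
    using der has_derivative_continuous by (blast intro: continuous_at_imp_continuous_on)
  then have [measurable]: "g \<in> borel_measurable borel"
    by (rule borel_measurable_continuous_onI)
  note [measurable] = meas
  fix l u :: "real^'m::_"
  assume le: "\<And>b. b \<in> Basis \<Longrightarrow> l \<bullet> b \<le> u \<bullet> b"
  define S where "S = g -` box l u"
  have "open S"
    unfolding S_def using cont by (rule open_vimage[OF open_box])
  then have S [measurable]: "S \<in> sets borel" by simp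
  have image: "g ` S = box l u"
    unfolding S_def using bij by (simp add: bij_is_surj surj_image_vimage_eq)
  have "g ` S \<in> lmeasurable \<and> measure lebesgue (g ` S) = (\<Prod>b\<in>Basis. (u - l) \<bullet> b)"
    unfolding image using le by (simp add: measure_lborel_box_eq)
  then have "((\<lambda>x. \<bar>det (matrix (g' x))\<bar>) has_integral (\<Prod>b\<in>Basis. (u - l) \<bullet> b)) S"
    using S bij der
    by (subst (asm) has_measure_differentiable_image)
       (auto intro: has_derivative_at_withinI inj_on_subset[OF bij_is_inj])
  then have "(\<integral>\<^sup>+x. ennreal \<bar>det (matrix (g' x))\<bar> * indicator S x \<partial>lborel) = (\<Prod>b\<in>Basis. (u - l) \<bullet> b)"
    by (intro nn_integral_has_integral_lebesgue') auto
  then show "emeasure (distr (density lborel (\<lambda>x. ennreal \<bar>det (matrix (g' x))\<bar>)) borel g) (box l u) =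
      ennreal (\<Prod>b\<in>Basis. (u - l) \<bullet> b)"
    using S by (simp add: emeasure_distr emeasure_density flip: S_def)
qed simp

text \<open>
  The change-of-variables theorem of HOL-Analysis needs a well-ordered index type, whereas our
  \<open>'n\<close> is merely finite.  Renaming the coordinates along a bijection of \<open>'n\<close> with the following
  well-ordered copy of it removes that restriction.
\<close>

typedef ('n::finite) ordered_index = "{..<CARD('n)}"
  by (auto intro: exI[of _ 0])

instantiation ordered_index :: (finite) linorder
begin

definition less_eq_ordered_index :: "'a ordered_index \<Rightarrow> 'a ordered_index \<Rightarrow> bool" where
  "less_eq_ordered_index a b \<longleftrightarrow> Rep_ordered_index a \<le> Rep_ordered_index b"

definition less_ordered_index :: "'a ordered_index \<Rightarrow> 'a ordered_index \<Rightarrow> bool" where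
  "less_ordered_index a b \<longleftrightarrow> Rep_ordered_index a < Rep_ordered_index b"

instance
  by standard (auto simp: less_eq_ordered_index_def less_ordered_index_def Rep_ordered_index_inject)

end

instance ordered_index :: (finite) wellorder
proof
  fix P :: "'a ordered_index \<Rightarrow> bool" and a
  assume step: "\<And>x. (\<And>y. y < x \<Longrightarrow> P y) \<Longrightarrow> P x"
  show "P a"
    by (induction a rule: measure_induct_rule[of Rep_ordered_index])
       (auto intro: step simp: less_ordered_index_def)
qed

lemma bij_betw_Rep_ordered_index:
  "bij_betw Rep_ordered_index (UNIV :: 'n ordered_index set) {..<CARD('n::finite)}"
  by (intro bij_betwI[where g=Abs_ordered_index])
    (use Rep_ordered_index in \<open>auto simp: Rep_ordered_index_inverse Abs_ordered_index_inverse\<close>)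

instance ordered_index :: (finite) finite
proof
  show "finite (UNIV :: 'a ordered_index set)"
    using bij_betw_finite[OF bij_betw_Rep_ordered_index[where 'n='a]] by simp
qed

lemma ex_bij_ordered_index: "\<exists>q :: 'n::finite \<Rightarrow> 'n ordered_index. bij q"
proof -
  have "card (UNIV :: 'n set) = card (UNIV :: 'n ordered_index set)"
    using bij_betw_same_card[OF bij_betw_Rep_ordered_index[where 'n='n]] by simp
  then show ?thesis
    by (intro finite_same_card_bij) auto
qed

text \<open>The preimage of a box under a renaming of coordinates is a box with the same side
  lengths in another order.\<close>

lemma lborel_distr_reindex:
  fixes q :: "'n::finite \<Rightarrow> 'm::finite"
  assumes q: "bij q"
  shows "distr lborel borel (\<lambda>y::real^'m. \<chi> i. y $ q i) = (lborel :: (real^'n) measure)"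
proof (rule lborel_eqI[symmetric])
  let ?T = "\<lambda>y::real^'m. (\<chi> i. y $ q i) :: real^'n"
  let ?R = "\<lambda>x::real^'n. (\<chi> j. x $ inv q j) :: real^'m"
  have inv1: "q (inv q x) = x" for x
    using q by (simp add: bij_is_surj surj_f_inv_f)
  have inv2: "inv q (q x) = x" for x
    using q by (simp add: bij_is_inj)
  have [measurable]: "?T \<in> borel_measurable borel"
    by (intro borel_measurable_continuous_onI continuous_intros)
  fix l u :: "real^'n"
  assume le: "\<And>b. b \<in> Basis \<Longrightarrow> l \<bullet> b \<le> u \<bullet> b"
  then have le': "l $ i \<le> u $ i" for i
    by (force simp: Basis_cart inner_axis)
  have eq: "?T -` box l u = box (?R l) (?R u)"
  proof -
    have "(\<forall>i. l $ i < y $ q i \<and> y $ q i < u $ i) \<longleftrightarrow> (\<forall>j. l $ inv q j < y $ j \<and> y $ j < u $ inv q j)" for y :: "real^'m"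
      by (metis inv1 inv2)
    then show ?thesis
      by (auto simp: mem_box_cart)
  qed
  have "(\<Prod>b\<in>Basis. (?R u - ?R l) \<bullet> b) = (\<Prod>j\<in>UNIV. (u - l) $ inv q j)"
    by (simp add: prod_Basis_cart inner_axis)
  also have "\<dots> = (\<Prod>i\<in>UNIV. (u - l) $ i)"
    by (rule prod.reindex_bij_betw[OF bij_imp_bij_inv[OF q]])
  also have "\<dots> = (\<Prod>b\<in>Basis. (u - l) \<bullet> b)"
    by (simp add: prod_Basis_cart inner_axis)
  finally show "emeasure (distr lborel borel ?T) (box l u) = ennreal (\<Prod>b\<in>Basis. (u - l) \<bullet> b)"
    using le' by (simp add: emeasure_distr eq emeasure_lborel_box_eq Basis_cart inner_axis)
qed simp

text \<open>The map \<open>h\<close>, which is \<open>g\<close> conjugated by the renaming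
  \<open>T\<close>, acts on a space with well-ordered indices. By \<open>det_reindex\<close> it has
  the same Jacobian determinant at corresponding points, and \<open>T\<close> preserves Lebesgue
  measure.\<close>

theorem lborel_eq_distr_density_det:
  fixes g :: "real^'n \<Rightarrow> real^'n"
  assumes der: "\<And>x. (g has_derivative g' x) (at x)"
    and bij: "bij g"
    and meas [measurable]: "(\<lambda>x. \<bar>det (matrix (g' x))\<bar>) \<in> borel_measurable borel"
  shows "distr (density lborel (\<lambda>x. ennreal \<bar>det (matrix (g' x))\<bar>)) borel g = lborel"
proof -
  obtain q :: "'n \<Rightarrow> 'n ordered_index" where q: "bij q"
    using ex_bij_ordered_index by blast
  define T :: "real^'n ordered_index \<Rightarrow> real^'n" where "T = (\<lambda>y. \<chi> i. y $ q i)"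
  define R :: "real^'n \<Rightarrow> real^'n ordered_index" where "R = (\<lambda>x. \<chi> j. x $ inv q j)"
  have inv1: "q (inv q x) = x" for x
    using q by (simp add: bij_is_surj surj_f_inv_f)
  have inv2: "inv q (q x) = x" for x
    using q by (simp add: bij_is_inj)
  have RT: "R (T y) = y" and TR: "T (R x) = x" for x y
    by (simp_all add: R_def T_def vec_eq_iff inv1 inv2)
  have linT: "bounded_linear T" and linR: "bounded_linear R"
    unfolding T_def R_def
    by (auto intro!: linear_conv_bounded_linear[THEN iffD1] linearI simp: vec_eq_iff)
  have contg: "continuous_on UNIV g"
    using der has_derivative_continuous by (blast intro: continuous_at_imp_continuous_on)
  have [measurable]: "T \<in> borel_measurable borel" "R \<in> borel_measurable borel" "g \<in> borel_measurable borel"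
    using linT linR contg
    by (auto intro!: borel_measurable_continuous_onI linear_continuous_on)
  define h where "h = R \<circ> g \<circ> T"
  define h' where "h' = (\<lambda>y. R \<circ> g' (T y) \<circ> T)"
  have bijT: "bij T" and bijR: "bij R"
    using o_bij[of R T] o_bij[of T R] RT TR by (auto simp: fun_eq_iff)
  have bijh: "bij h"
    unfolding h_def using bij bijT bijR by (simp add: bij_comp)
  have derh: "(h has_derivative h' y) (at y)" for y
    unfolding h_def h'_def
    by (rule diff_chain_at diff_chain_at[OF bounded_linear_imp_has_derivative[OF linT]]
      bounded_linear_imp_has_derivative[OF linR] der)+
  have T_axis: "T (axis b 1) = axis (inv q b) 1" for b
    by (auto simp: T_def vec_eq_iff axis_def inv1 inv2)
  have deth: "det (matrix (h' y)) = det (matrix (g' (T y)))" for y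
  proof -
    have "matrix (h' y) = (\<chi> a b. matrix (g' (T y)) $ inv q a $ inv q b)"
      by (simp add: matrix_def h'_def vec_eq_iff T_axis) (simp add: R_def)
    then show ?thesis
      by (simp add: det_reindex bij_imp_bij_inv q)
  qed
  have distrT: "distr lborel borel T = lborel"
    unfolding T_def by (rule lborel_distr_reindex[OF q])
  have Th: "T \<circ> h = g \<circ> T"
    by (auto simp: h_def TR)
  have [measurable]: "h \<in> borel_measurable borel"
    unfolding h_def by measurable
  let ?J = "\<lambda>x. ennreal \<bar>det (matrix (g' x))\<bar>"
  \<comment> \<open>\<open>T\<close> is pulled out of the density and then moved past
    \<open>g\<close> by \<open>T \<circ> h = g \<circ> T\<close>. What remains inside is the
    well-ordered case for \<open>h\<close>.\<close>
  have "distr (density lborel ?J) borel g = distr (density (distr lborel borel T) ?J) borel g"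
    by (simp only: distrT)
  also have "\<dots> = distr (distr (density lborel (\<lambda>y. ?J (T y))) borel T) borel g"
    by (subst density_distr) (auto simp: comp_def)
  also have "\<dots> = distr (density lborel (\<lambda>y. ?J (T y))) borel (T \<circ> h)"
    by (subst distr_distr) (auto simp: Th)
  also have "\<dots> = distr (distr (density lborel (\<lambda>y. ?J (T y))) borel h) borel T"
    by (subst distr_distr) auto
  also have "distr (density lborel (\<lambda>y. ?J (T y))) borel h = lborel"
    using distr_density_det_wellorder[OF derh bijh] by (simp add: deth)
  finally show ?thesis
    by (simp only: distrT)
qed

subsection \<open>The Fourier transform of Schwartz functions\<close>

text \<open>Without the normalising constant of \<open>weighted_fourier\<close>; hence the factor
  \<open>(2 * pi) ^ CARD('n)\<close> in the inversion results.\<close>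

definition fourier :: "(real^'n \<Rightarrow> complex) \<Rightarrow> real^'n \<Rightarrow> complex" where
  "fourier g \<xi> = (LINT y|lborel. exp (- (\<i> * complex_of_real (\<xi> \<bullet> y))) * g y)"

lemma fourier_measurable:
  assumes [measurable]: "g \<in> borel_measurable borel"
  shows "fourier g \<in> borel_measurable borel"
  unfolding fourier_def by measurable

lemma norm_fourier_le:
  assumes "integrable lborel g"
  shows "norm (fourier g \<xi>) \<le> (LINT y|lborel. norm (g y))"
  unfolding fourier_def
  by (rule order_trans[OF integral_norm_bound]) (simp add: norm_mult)

text \<open>The product form makes integrability a one-dimensional matter, and its reciprocal is a
  polynomial, so that bounds against monomials control decay.\<close>

definition decay_weight :: "real^'n \<Rightarrow> real" where
  "decay_weight x = (\<Prod>i\<in>UNIV. inverse (1 + (x $ i)\<^sup>2))"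

lemma le_decay_weight:
  assumes "(\<Prod>i\<in>UNIV. 1 + (x $ i)\<^sup>2) * r \<le> C"
  shows "r \<le> C * decay_weight x"
proof -
  have "0 < (\<Prod>i\<in>UNIV. 1 + (x $ i)\<^sup>2)"
    by (intro prod_pos) (simp add: add_pos_nonneg)
  moreover have "decay_weight x = inverse (\<Prod>i\<in>UNIV. 1 + (x $ i)\<^sup>2)"
    unfolding decay_weight_def by (rule prod_inversef[unfolded comp_def])
  ultimately show ?thesis
    using assms by (simp add: field_simps)
qed

lemma integrable_decay_weight: "integrable lborel (decay_weight :: real^'n \<Rightarrow> real)"
proof -
  have "integrable lborel (\<lambda>t::real. inverse (1 + t\<^sup>2))"
    using integrable_inverse_1_plus_square
    by (simp add: set_integrable_def einterval_eq(3))
  then show ?thesis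
    unfolding decay_weight_def
    by (intro integrable_lborel_cart_prod[where f="\<lambda>_ t. inverse (1 + t\<^sup>2)"])
qed

text \<open>Serves to dominate difference quotients: the mean value inequality bounds them by
  derivatives at shifted points, and this estimate removes the shift.\<close>

lemma decay_weight_translate_le:
  fixes x :: "real^'n"
  assumes "\<bar>s\<bar> \<le> 1"
  shows "decay_weight (x + s *\<^sub>R axis i 1) \<le> 3 ^ CARD('n) * decay_weight x"
proof -
  have "inverse (1 + (y + t)\<^sup>2) \<le> 3 * inverse (1 + y\<^sup>2)" if "\<bar>t\<bar> \<le> 1" for y t :: real
  proof -
    \<comment> \<open>The difference of the two sides is the square of
      \<open>y + 2 * t\<close>.\<close>
    have "y\<^sup>2 \<le> 2 * (y + t)\<^sup>2 + 2 * t\<^sup>2"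
      using zero_le_power2[of "y + 2 * t"] by (simp add: power2_eq_square algebra_simps)
    moreover have "t\<^sup>2 \<le> 1"
      using that by (simp add: abs_square_le_1)
    moreover have "1 + a \<le> 3 * (1 + b)" if "a \<le> 2 * b + 2 * c" "c \<le> 1" "0 \<le> b" for a b c :: real
      using that by simp
    ultimately have "1 + y\<^sup>2 \<le> 3 * (1 + (y + t)\<^sup>2)"
      using zero_le_power2 by blast
    moreover have "0 < 1 + y\<^sup>2" "0 < 1 + (y + t)\<^sup>2"
      by (simp_all add: add_pos_nonneg)
    ultimately show ?thesis
      by (simp add: field_simps)
  qed
  \<comment> \<open>Only coordinate \<open>i\<close> moves. The others are shifted by 0, and the
    factor 3 is spent on them too in order to treat all coordinates alike.\<close>
  then have "decay_weight (x + s *\<^sub>R axis i 1) \<le> (\<Prod>j\<in>UNIV. 3 * inverse (1 + (x $ j)\<^sup>2))"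
    unfolding decay_weight_def using assms
    by (intro prod_mono) (auto simp: axis_def)
  also have "\<dots> = 3 ^ CARD('n) * decay_weight x"
    unfolding decay_weight_def by (simp add: prod.distrib)
  finally show ?thesis .
qed

section \<open>Derivatives and decay of Schwartz functions\<close>

lemma smooth_continuous: "smooth f \<Longrightarrow> continuous_on UNIV f"
  using Ck.simps(1) unfolding smooth_def by blast

lemma smooth_differentiable: "smooth f \<Longrightarrow> f differentiable at x"
  using Ck.simps(2) unfolding smooth_def by blast

lemma smooth_frechet_derivative: "smooth f \<Longrightarrow> smooth (\<lambda>x. frechet_derivative f (at x) v)"
  using Ck.simps(2) unfolding smooth_def by blast

lemma smooth_has_derivative: "smooth f \<Longrightarrow> (f has_derivative frechet_derivative f (at x)) (at x)"
  using smooth_differentiable frechet_derivative_works by blast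

lemma schwartz_partial_deriv:
  assumes "g \<in> schwartz_space"
  shows "partial_deriv i g \<in> schwartz_space"
proof -
  \<comment> \<open>The head of the list is the derivative taken last, so a derivative taken first
    is appended at the end.\<close>
  have "iter_partial is (partial_deriv i g) = iter_partial (is @ [i]) g" for "is"
    by (induction "is") auto
  then show ?thesis
    using assms unfolding schwartz_space_def
    by (auto simp: partial_deriv_def smooth_frechet_derivative simp del: iter_partial.simps)
qed

text \<open>Multiplying out the product of the factors \<open>1 + (x $ i)\<^sup>2\<close> leaves
  finitely many monomials times \<open>g\<close>, each of them bounded. The induction treats one
  factor at a time.\<close>

lemma schwartz_decay:
  fixes g :: "real^'n \<Rightarrow> complex"
  assumes g: "g \<in> schwartz_space"
  shows "\<exists>C. \<forall>x. norm (g x) \<le> C * decay_weight x"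
proof -
  \<comment> \<open>The exponent \<alpha> has to vary, since the square in a new factor raises
    \<open>\<alpha> i\<close> by 2.\<close>
  have "\<exists>C. \<forall>x. (\<Prod>i\<in>A. 1 + (x $ i)\<^sup>2) * norm (complex_of_real (monomial \<alpha> x) * g x) \<le> C"
    if "finite A" for A \<alpha>
    using that
  proof (induction A arbitrary: \<alpha>)
    case empty
    have "bounded (range (\<lambda>x. complex_of_real (monomial \<alpha> x) * iter_partial [] g x))"
      using g unfolding schwartz_space_def by blast
    then show ?case
      by (auto simp: bounded_iff)
  next
    case (insert i A)
    let ?M = "\<lambda>\<alpha> x. norm (complex_of_real (monomial \<alpha> x) * g x)"
    let ?\<beta> = "\<alpha>(i := \<alpha> i + 2)"
    obtain C D where C: "\<And>x. (\<Prod>i\<in>A. 1 + (x $ i)\<^sup>2) * ?M \<alpha> x \<le> C"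
      and D: "\<And>x. (\<Prod>i\<in>A. 1 + (x $ i)\<^sup>2) * ?M ?\<beta> x \<le> D"
      using insert.IH by metis
    have "monomial ?\<beta> x = (x $ i)\<^sup>2 * monomial \<alpha> x" for x
      unfolding monomial_def prod.remove[OF finite_class.finite_UNIV UNIV_I[of i]]
      by (simp add: power_add power2_eq_square)
    then have "?M ?\<beta> x = (x $ i)\<^sup>2 * ?M \<alpha> x" for x
      by (simp add: norm_mult abs_mult norm_power)
    then have "(\<Prod>i\<in>insert i A. 1 + (x $ i)\<^sup>2) * ?M \<alpha> x =
        (\<Prod>i\<in>A. 1 + (x $ i)\<^sup>2) * ?M \<alpha> x + (\<Prod>i\<in>A. 1 + (x $ i)\<^sup>2) * ?M ?\<beta> x" for x
      using insert.hyps by (simp add: algebra_simps)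
    then show ?case
      using add_mono[OF C D] by (intro exI[of _ "C + D"]) simp
  qed
  from this[of UNIV "\<lambda>_. 0"] obtain C where C: "\<And>x. (\<Prod>i\<in>UNIV. 1 + (x $ i)\<^sup>2) * norm (g x) \<le> C"
    by (auto simp: monomial_def)
  then show ?thesis
    using le_decay_weight by blast
qed

lemma decay_integrable:
  fixes g :: "real^'n \<Rightarrow> complex"
  assumes "g \<in> borel_measurable borel" and "\<And>x. norm (g x) \<le> C * decay_weight x"
  shows "integrable lborel g"
  by (rule Bochner_Integration.integrable_bound[OF integrable_mult_right[OF integrable_decay_weight, of C]])
     (use assms(1) order_trans[OF assms(2) abs_ge_self] in auto)

lemma schwartz_measurable: "g \<in> schwartz_space \<Longrightarrow> g \<in> borel_measurable borel"
  unfolding schwartz_space_def by (auto intro: borel_measurable_continuous_onI smooth_continuous)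

lemma schwartz_integrable: "g \<in> schwartz_space \<Longrightarrow> integrable lborel g"
  using schwartz_decay decay_integrable schwartz_measurable by blast

section \<open>Translation and differentiation under the transform\<close>

lemma fourier_translate:
  fixes g :: "real^'n \<Rightarrow> complex"
  assumes [measurable]: "g \<in> borel_measurable borel"
  shows "fourier (\<lambda>x. g (x + v)) \<xi> = exp (\<i> * complex_of_real (\<xi> \<bullet> v)) * fourier g \<xi>"
proof -
  have "fourier (\<lambda>x. g (x + v)) \<xi> = (LINT x|lborel. exp (\<i> * complex_of_real (\<xi> \<bullet> v)) *
      (exp (- (\<i> * complex_of_real (\<xi> \<bullet> (x + v)))) * g (x + v)))"
    unfolding fourier_def
    by (intro Bochner_Integration.integral_cong) (simp_all add: inner_add_right ring_distribs flip: mult.assoc exp_add)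
  also have "\<dots> = (LINT x|lborel. exp (\<i> * complex_of_real (\<xi> \<bullet> v)) *
      (exp (- (\<i> * complex_of_real (\<xi> \<bullet> x))) * g x))"
    by (intro lborel_integral_translate[of "\<lambda>x. exp (\<i> * complex_of_real (\<xi> \<bullet> v)) *
      (exp (- (\<i> * complex_of_real (\<xi> \<bullet> x))) * g x)"]) measurable
  finally show ?thesis
    by (simp add: fourier_def)
qed

lemma fourier_integrand_integrable:
  assumes "integrable lborel g"
  shows "integrable lborel (\<lambda>y. exp (- (\<i> * complex_of_real (\<xi> \<bullet> y))) * g y)"
  by (rule Bochner_Integration.integrable_bound[OF assms]) (use assms in \<open>auto simp: norm_mult\<close>)

text \<open>This is the infinitesimal form of \<open>fourier_translate\<close>, obtained by a limit
  instead of an integration by parts.\<close>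

lemma fourier_partial_deriv:
  fixes g :: "real^'n \<Rightarrow> complex"
  assumes g: "g \<in> schwartz_space"
  shows "fourier (partial_deriv i g) \<xi> = \<i> * complex_of_real (\<xi> $ i) * fourier g \<xi>"
proof -
  let ?d = "partial_deriv i g"
  let ?e = "axis i 1 :: real^'n"
  \<comment> \<open>A sequence of steps, as dominated convergence is used for sequences; steps of at
    most 1 stay within the range of \<open>decay_weight_translate_le\<close>.\<close>
  define t where "t n = inverse (real (Suc n))" for n
  have t: "0 < t n" "t n \<le> 1" for n
    by (auto simp: t_def field_simps)
  have t0: "t \<longlonglongrightarrow> 0"
    unfolding t_def by (rule LIMSEQ_inverse_real_of_nat)
  have [measurable]: "g \<in> borel_measurable borel" "?d \<in> borel_measurable borel"
    using g schwartz_partial_deriv schwartz_measurable by blast+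
  have smooth: "smooth g" using g by (simp add: schwartz_space_def)
  obtain C where C: "norm (?d x) \<le> C * decay_weight x" for x
    using schwartz_decay[OF schwartz_partial_deriv[OF g]] by blast
  have der: "((\<lambda>s. g (x + s *\<^sub>R ?e)) has_vector_derivative ?d (x + s *\<^sub>R ?e)) (at s)" for x s
  proof -
    have "((\<lambda>s. x + s *\<^sub>R ?e) has_vector_derivative ?e) (at s)"
      by (auto intro!: derivative_eq_intros)
    then show ?thesis
      using vector_derivative_diff_chain_within[of "\<lambda>s. x + s *\<^sub>R ?e" ?e s UNIV g "frechet_derivative g (at (x + s *\<^sub>R ?e))"]
        has_derivative_at_withinI[OF smooth_has_derivative[OF smooth]]
      by (simp add: comp_def partial_deriv_def)
  qed
  \<comment> \<open>Both sides are the limit of the transforms of the difference quotients of \<open>g\<close> in direction \<open>i\<close>,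
    which are dominated by a multiple of the weight.\<close>
  define q where "q n x = (g (x + t n *\<^sub>R ?e) - g x) / complex_of_real (t n)" for n x
  have C0: "0 \<le> C"
  proof -
    have "0 < decay_weight (0 :: real^'n)" by (simp add: decay_weight_def)
    then show ?thesis
      using order_trans[OF norm_ge_zero C[of 0]] by (simp add: zero_le_mult_iff)
  qed
  have q_bound: "norm (q n x) \<le> C * 3 ^ CARD('n) * decay_weight x" for n x
  proof -
    \<comment> \<open>Mean value inequality in the parameter \<open>s\<close> on the unit interval,
      which contains both 0 and \<open>t n\<close>; the bound on the derivative is uniform in
      \<open>s\<close>.\<close>
    have "norm (g (x + t n *\<^sub>R ?e) - g (x + 0 *\<^sub>R ?e)) \<le> (C * (3 ^ CARD('n) * decay_weight x)) * norm (t n - 0)"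
    proof (rule differentiable_bound[where S="{0..1}" and f'="\<lambda>s h. h *\<^sub>R ?d (x + s *\<^sub>R ?e)"])
      fix s :: real assume s: "s \<in> {0..1}"
      show "((\<lambda>s. g (x + s *\<^sub>R ?e)) has_derivative (\<lambda>h. h *\<^sub>R ?d (x + s *\<^sub>R ?e))) (at s within {0..1})"
        using der by (simp add: has_vector_derivative_def has_derivative_at_withinI)
      have "norm (?d (x + s *\<^sub>R ?e)) \<le> C * (3 ^ CARD('n) * decay_weight x)"
        using s by (intro order_trans[OF C] mult_left_mono decay_weight_translate_le C0) auto
      then show "onorm (\<lambda>h. h *\<^sub>R ?d (x + s *\<^sub>R ?e)) \<le> C * (3 ^ CARD('n) * decay_weight x)"
        by (intro onorm_le) (simp add: mult.commute mult_left_mono)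
    qed (use t[of n] in auto)
    then show ?thesis
      using t[of n] by (simp add: q_def norm_divide field_simps)
  qed
  have q_lim: "(\<lambda>n. q n x) \<longlonglongrightarrow> ?d x" for x
  proof -
    have "((\<lambda>s. (g (x + s *\<^sub>R ?e) - g x) /\<^sub>R s) \<longlongrightarrow> ?d x) (at 0)"
    proof (rule LIM_zero_cancel, rule tendsto_norm_zero_cancel, rule Lim_transform_eventually)
      show "((\<lambda>s. norm (g (x + s *\<^sub>R ?e) - g x - s *\<^sub>R ?d x) / norm s) \<longlongrightarrow> 0) (at 0)"
        using der[of x 0] by (simp add: has_vector_derivative_def has_derivative_iff_norm)
      have "norm (g (x + s *\<^sub>R ?e) - g x - s *\<^sub>R ?d x) / norm s = norm ((g (x + s *\<^sub>R ?e) - g x) /\<^sub>R s - ?d x)" if "s \<noteq> 0" for s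
      proof -
        have "(g (x + s *\<^sub>R ?e) - g x) /\<^sub>R s - ?d x = (g (x + s *\<^sub>R ?e) - g x - s *\<^sub>R ?d x) /\<^sub>R s"
          using that by (simp add: scaleR_diff_right)
        then show ?thesis
          by (simp add: divide_inverse mult.commute)
      qed
      then show "\<forall>\<^sub>F s in at 0. norm (g (x + s *\<^sub>R ?e) - g x - s *\<^sub>R ?d x) / norm s =
          norm ((g (x + s *\<^sub>R ?e) - g x) /\<^sub>R s - ?d x)"
        by (auto simp: eventually_at intro!: exI[of _ 1])
    qed
    moreover have "filterlim t (at 0) sequentially"
      using t0 t(1) by (auto simp: filterlim_at less_imp_neq[symmetric] intro!: always_eventually)
    ultimately have "(\<lambda>n. (g (x + t n *\<^sub>R ?e) - g x) /\<^sub>R t n) \<longlonglongrightarrow> ?d x"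
      by (rule filterlim_compose)
    then show ?thesis
      by (simp add: q_def scaleR_conv_of_real divide_inverse mult.commute)
  qed
  have "(\<lambda>n. fourier (q n) \<xi>) \<longlonglongrightarrow> fourier ?d \<xi>"
    unfolding fourier_def
  proof (rule integral_dominated_convergence[where w="\<lambda>x. C * 3 ^ CARD('n) * decay_weight x"])
    show "integrable lborel (\<lambda>x. C * 3 ^ CARD('n) * decay_weight (x :: real^'n))"
      by (intro integrable_mult_right integrable_decay_weight)
    show "(\<lambda>y. exp (- (\<i> * complex_of_real (\<xi> \<bullet> y))) * q n y) \<in> borel_measurable lborel" for n
      unfolding q_def by measurable
  qed (auto intro!: tendsto_mult q_lim simp: norm_mult q_bound)
  moreover have "fourier (q n) \<xi> = (exp (\<i> * complex_of_real (\<xi> $ i) * complex_of_real (t n)) - 1) / complex_of_real (t n) * fourier g \<xi>" for n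
  proof -
    have int: "integrable lborel g" "integrable lborel (\<lambda>x. g (x + t n *\<^sub>R ?e))"
      using g schwartz_integrable lborel_integrable_translate by blast+
    have "fourier (q n) \<xi> = (LINT y|lborel. (exp (- (\<i> * complex_of_real (\<xi> \<bullet> y))) * g (y + t n *\<^sub>R ?e) -
        exp (- (\<i> * complex_of_real (\<xi> \<bullet> y))) * g y) / complex_of_real (t n))"
      by (simp add: fourier_def q_def right_diff_distrib)
    also have "\<dots> = (fourier (\<lambda>x. g (x + t n *\<^sub>R ?e)) \<xi> - fourier g \<xi>) / complex_of_real (t n)"
      using int by (simp add: fourier_def fourier_integrand_integrable)
    also have "fourier (\<lambda>x. g (x + t n *\<^sub>R ?e)) \<xi> = exp (\<i> * complex_of_real (\<xi> $ i) * complex_of_real (t n)) * fourier g \<xi>"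
      by (simp add: fourier_translate inner_axis ac_simps)
    finally show ?thesis
      by (simp add: field_simps)
  qed
  ultimately have lim1: "(\<lambda>n. (exp (\<i> * complex_of_real (\<xi> $ i) * complex_of_real (t n)) - 1) / complex_of_real (t n) * fourier g \<xi>)
      \<longlonglongrightarrow> fourier ?d \<xi>"
    by simp
  \<comment> \<open>The multiplier of \<open>fourier g \<xi>\<close> is a difference quotient of
    this function at 0, with \<open>z\<close> equal to
    \<open>\<i> * complex_of_real (\<xi> $ i)\<close>.\<close>
  have "((\<lambda>h. exp (z * h)) has_field_derivative z) (at 0)" for z :: complex
    by (auto intro!: derivative_eq_intros)
  then have "((\<lambda>h. (exp (\<i> * complex_of_real (\<xi> $ i) * h) - 1) / h) \<longlongrightarrow> \<i> * complex_of_real (\<xi> $ i)) (at 0)"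
    by (simp add: DERIV_def)
  moreover have "filterlim (\<lambda>n. complex_of_real (t n)) (at 0) sequentially"
    using t(1) tendsto_of_real[OF t0] by (auto simp: filterlim_at less_imp_neq[symmetric] intro!: always_eventually)
  ultimately have "(\<lambda>n. (exp (\<i> * complex_of_real (\<xi> $ i) * complex_of_real (t n)) - 1) / complex_of_real (t n))
      \<longlonglongrightarrow> \<i> * complex_of_real (\<xi> $ i)"
    by (rule filterlim_compose)
  then have "(\<lambda>n. (exp (\<i> * complex_of_real (\<xi> $ i) * complex_of_real (t n)) - 1) / complex_of_real (t n) * fourier g \<xi>)
      \<longlonglongrightarrow> \<i> * complex_of_real (\<xi> $ i) * fourier g \<xi>"
    by (intro tendsto_mult tendsto_const)
  with lim1 show ?thesis
    by (rule LIMSEQ_unique)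
qed

text \<open>Multiplying the modulus of the transform by \<open>1 + (\<xi> $ i)\<^sup>2\<close> adds
  the modulus of the transform of the second partial derivative, again a Schwartz function.
  Induction over the coordinates, with \<open>g\<close> varying, reduces decay to the boundedness of
  transforms.\<close>

lemma schwartz_fourier_integrable:
  fixes g :: "real^'n \<Rightarrow> complex"
  assumes g: "g \<in> schwartz_space"
  shows "integrable lborel (fourier g)"
proof -
  have "\<exists>C. \<forall>\<xi>. (\<Prod>i\<in>A. 1 + (\<xi> $ i)\<^sup>2) * norm (fourier g \<xi>) \<le> C" if "finite A" for A
    using that g
  proof (induction A arbitrary: g)
    case empty
    then show ?case
      using norm_fourier_le[OF schwartz_integrable[OF empty]] by auto
  next
    case (insert i A)
    let ?h = "partial_deriv i (partial_deriv i g)"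
    obtain C D where C: "\<And>\<xi>. (\<Prod>i\<in>A. 1 + (\<xi> $ i)\<^sup>2) * norm (fourier g \<xi>) \<le> C"
      and D: "\<And>\<xi>. (\<Prod>i\<in>A. 1 + (\<xi> $ i)\<^sup>2) * norm (fourier ?h \<xi>) \<le> D"
      using insert.IH insert.prems schwartz_partial_deriv by metis
    have "norm (fourier ?h \<xi>) = (\<xi> $ i)\<^sup>2 * norm (fourier g \<xi>)" for \<xi>
      using insert.prems
      by (simp add: fourier_partial_deriv schwartz_partial_deriv norm_mult power2_eq_square)
    then have "(\<Prod>i\<in>insert i A. 1 + (\<xi> $ i)\<^sup>2) * norm (fourier g \<xi>) =
        (\<Prod>i\<in>A. 1 + (\<xi> $ i)\<^sup>2) * norm (fourier g \<xi>) + (\<Prod>i\<in>A. 1 + (\<xi> $ i)\<^sup>2) * norm (fourier ?h \<xi>)" for \<xi>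
      using insert.hyps by (simp add: algebra_simps)
    then show ?case
      using add_mono[OF C D] by (intro exI[of _ "C + D"]) simp
  qed
  from this[of UNIV] obtain C where C: "\<And>\<xi>. (\<Prod>i\<in>UNIV. 1 + (\<xi> $ i)\<^sup>2) * norm (fourier g \<xi>) \<le> C"
    by auto
  then show ?thesis
    by (intro decay_integrable[OF fourier_measurable[OF schwartz_measurable[OF g]]] le_decay_weight)
qed

subsection \<open>Fourier inversion\<close>

lemma gaussian_uminus: "gaussian (- x) = gaussian x"
  by (simp add: gaussian_def)

text \<open>Both sides are iterated integrals of the same \<open>F\<close>. Integrating over
  \<open>y\<close> first produces the transform of \<open>g\<close>; integrating over \<xi> first
  produces a Gaussian kernel of width \<epsilon> around \<open>x\<close>.\<close>

lemma fourier_gaussian_mean: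
  fixes g :: "real^'n \<Rightarrow> complex"
  assumes int: "integrable lborel g" and e: "0 < \<epsilon>"
  shows "(LINT \<xi>|lborel. exp (\<i> * complex_of_real (\<xi> \<bullet> x)) * fourier g \<xi> * complex_of_real (gaussian (\<epsilon> *\<^sub>R \<xi>))) =
    complex_of_real (sqrt (2 * pi) ^ CARD('n)) * (LINT z|lborel. g (x + \<epsilon> *\<^sub>R z) * complex_of_real (gaussian z))"
proof -
  have [measurable]: "g \<in> borel_measurable borel"
    using int by auto
  define F where "F \<xi> y = exp (\<i> * complex_of_real (\<xi> \<bullet> (x - y))) * complex_of_real (gaussian (\<epsilon> *\<^sub>R \<xi>)) * g y" for \<xi> y
  have gauss_eps: "integrable lborel (\<lambda>\<xi>::real^'n. gaussian (\<epsilon> *\<^sub>R \<xi>))"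
  proof -
    have "integrable (distr lborel borel (\<lambda>\<xi>::real^'n. \<epsilon> *\<^sub>R \<xi>)) gaussian"
    proof -
      have "integrable (density (distr lborel borel (\<lambda>\<xi>::real^'n. 0 + \<epsilon> *\<^sub>R \<xi>)) (\<lambda>_. \<bar>\<epsilon>\<bar> ^ DIM(real^'n))) gaussian"
        using e by (subst lborel_affine[symmetric]) (auto intro: gaussian_integrable)
      then show ?thesis
        using e by (subst (asm) integrable_density) auto
    qed
    then show ?thesis
      by (subst (asm) integrable_distr_eq) auto
  qed
  have "integrable (lborel \<Otimes>\<^sub>M lborel) (case_prod F)"
  proof (rule lborel_pair.Fubini_integrable)
    show "case_prod F \<in> borel_measurable (lborel \<Otimes>\<^sub>M lborel)"
      unfolding F_def by measurable
    \<comment> \<open>The exponential has modulus 1, so the modulus of \<open>F\<close> separates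
      into a function of \<xi> and a function of \<open>y\<close>.\<close>
    have "(LINT y|lborel. norm (case_prod F (\<xi>, y))) = gaussian (\<epsilon> *\<^sub>R \<xi>) * (LINT y|lborel. norm (g y))" for \<xi>
      by (simp add: F_def norm_mult less_imp_le[OF gaussian_bounds(1)])
    then show "integrable lborel (\<lambda>\<xi>. LINT y|lborel. norm (case_prod F (\<xi>, y)))"
      using gauss_eps by simp
    have "integrable lborel (F \<xi>)" for \<xi>
      unfolding F_def
      by (rule Bochner_Integration.integrable_bound[OF int])
         (auto simp: norm_mult less_imp_le[OF gaussian_bounds(1)] intro!: mult_left_le_one_le gaussian_bounds(2))
    then show "AE \<xi> in lborel. integrable lborel (\<lambda>y. case_prod F (\<xi>, y))"
      by simp
  qed
  from lborel_pair.Fubini_integral[OF this]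
  have swap: "(LINT \<xi>|lborel. LINT y|lborel. F \<xi> y) = (LINT y|lborel. LINT \<xi>|lborel. F \<xi> y)" by simp
  have inner1: "(LINT y|lborel. F \<xi> y) = exp (\<i> * complex_of_real (\<xi> \<bullet> x)) * fourier g \<xi> * complex_of_real (gaussian (\<epsilon> *\<^sub>R \<xi>))" for \<xi>
  proof -
    have "(LINT y|lborel. F \<xi> y) = (LINT y|lborel. (exp (\<i> * complex_of_real (\<xi> \<bullet> x)) * complex_of_real (gaussian (\<epsilon> *\<^sub>R \<xi>))) *
        (exp (- (\<i> * complex_of_real (\<xi> \<bullet> y))) * g y))"
      by (intro Bochner_Integration.integral_cong)
         (simp_all add: F_def inner_diff_right right_diff_distrib exp_diff exp_minus field_simps)
    then show ?thesis
      by (simp add: fourier_def)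
  qed
  define K where "K = complex_of_real (sqrt (2 * pi) ^ CARD('n))"
  \<comment> \<open>Substituting \<open>\<eta> = \<epsilon> *\<^sub>R \<xi>\<close> gives the
    Gaussian transform at \<open>(1/\<epsilon>) *\<^sub>R (x - y)\<close>.\<close>
  have inner2: "(LINT \<xi>|lborel. F \<xi> y) = K * (g y * complex_of_real (gaussian ((1/\<epsilon>) *\<^sub>R (x - y)))) /\<^sub>R \<epsilon> ^ CARD('n)" for y
  proof -
    let ?G = "\<lambda>\<eta>. exp (\<i> * complex_of_real (((1/\<epsilon>) *\<^sub>R (x - y)) \<bullet> \<eta>)) * complex_of_real (gaussian \<eta>)"
    have "(LINT \<eta>|lborel. ?G \<eta>) = \<epsilon> ^ CARD('n) *\<^sub>R (LINT \<xi>|lborel. ?G (0 + \<epsilon> *\<^sub>R \<xi>))"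
      using e by (subst lborel_integral_affine[of \<epsilon> _ 0]) auto
    also have "(LINT \<eta>|lborel. ?G \<eta>) = K * complex_of_real (gaussian ((1/\<epsilon>) *\<^sub>R (x - y)))"
      by (simp only: gaussian_transform(2) K_def of_real_mult)
    finally have "(LINT \<xi>|lborel. ?G (0 + \<epsilon> *\<^sub>R \<xi>)) = (K * complex_of_real (gaussian ((1/\<epsilon>) *\<^sub>R (x - y)))) /\<^sub>R \<epsilon> ^ CARD('n)"
      using e by simp
    moreover have "(LINT \<xi>|lborel. F \<xi> y) = (LINT \<xi>|lborel. ?G (0 + \<epsilon> *\<^sub>R \<xi>)) * g y"
      using e by (simp add: F_def inner_commute)
    ultimately show ?thesis
      by simp
  qed
  \<comment> \<open>The substitution \<open>y = x + \<epsilon> *\<^sub>R z\<close> makes the kernel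
    independent of \<epsilon>; its Jacobian cancels the power of \<epsilon> in
    \<open>inner2\<close>.\<close>
  have "(LINT y|lborel. g y * complex_of_real (gaussian ((1/\<epsilon>) *\<^sub>R (x - y)))) =
      \<epsilon> ^ CARD('n) *\<^sub>R (LINT z|lborel. g (x + \<epsilon> *\<^sub>R z) * complex_of_real (gaussian z))"
    using e by (subst lborel_integral_affine[of \<epsilon> _ x]) (auto simp: gaussian_uminus)
  then have "(LINT y|lborel. LINT \<xi>|lborel. F \<xi> y) = K * (LINT z|lborel. g (x + \<epsilon> *\<^sub>R z) * complex_of_real (gaussian z))"
    unfolding inner2 using e by simp
  then show ?thesis
    using swap by (simp add: inner1 K_def)
qed

text \<open>Integrability of \<open>fourier g\<close> dominates the regularised integrals.
  Boundedness of \<open>g\<close> dominates the Gaussian means, and continuity makes them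
  concentrate on the value \<open>g x\<close>.\<close>

theorem fourier_inversion:
  fixes g :: "real^'n \<Rightarrow> complex"
  assumes int: "integrable lborel g" and int': "integrable lborel (fourier g)"
    and cont: "continuous_on UNIV g" and bounded: "bounded (range g)"
  shows "(LINT \<xi>|lborel. exp (\<i> * complex_of_real (\<xi> \<bullet> x)) * fourier g \<xi>) = complex_of_real ((2 * pi) ^ CARD('n)) * g x"
proof -
  have [measurable]: "g \<in> borel_measurable borel" "fourier g \<in> borel_measurable borel"
    using int int' by auto
  obtain B where B: "\<And>y. norm (g y) \<le> B"
    using bounded by (auto simp: bounded_iff)
  define t where "t n = inverse (real (Suc n))" for n
  have t: "0 < t n" for n by (simp add: t_def)
  have t0: "t \<longlonglongrightarrow> 0"
    unfolding t_def by (rule LIMSEQ_inverse_real_of_nat)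
  have gauss_lim: "(\<lambda>n. gaussian (t n *\<^sub>R \<xi>)) \<longlonglongrightarrow> 1" for \<xi> :: "real^'n"
  proof -
    have "(\<lambda>n. gaussian (t n *\<^sub>R \<xi>)) \<longlonglongrightarrow> gaussian (0 *\<^sub>R \<xi>)"
      using tendsto_scaleR[OF t0 tendsto_const[of \<xi>]]
      by (intro continuous_on_tendsto_compose[OF gaussian_continuous[of UNIV]]) auto
    then show ?thesis
      by (simp add: gaussian_def)
  qed
  have "(\<lambda>n. LINT \<xi>|lborel. exp (\<i> * complex_of_real (\<xi> \<bullet> x)) * fourier g \<xi> * complex_of_real (gaussian (t n *\<^sub>R \<xi>)))
      \<longlonglongrightarrow> (LINT \<xi>|lborel. exp (\<i> * complex_of_real (\<xi> \<bullet> x)) * fourier g \<xi>)"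
  proof (rule integral_dominated_convergence[where w="\<lambda>\<xi>. norm (fourier g \<xi>)"])
    have "(\<lambda>n. exp (\<i> * complex_of_real (\<xi> \<bullet> x)) * fourier g \<xi> * complex_of_real (gaussian (t n *\<^sub>R \<xi>)))
        \<longlonglongrightarrow> exp (\<i> * complex_of_real (\<xi> \<bullet> x)) * fourier g \<xi> * complex_of_real 1" for \<xi>
      by (intro tendsto_intros gauss_lim)
    then show "AE \<xi> in lborel. (\<lambda>n. exp (\<i> * complex_of_real (\<xi> \<bullet> x)) * fourier g \<xi> * complex_of_real (gaussian (t n *\<^sub>R \<xi>)))
        \<longlonglongrightarrow> exp (\<i> * complex_of_real (\<xi> \<bullet> x)) * fourier g \<xi>"
      by simp
    show "AE \<xi> in lborel. norm (exp (\<i> * complex_of_real (\<xi> \<bullet> x)) * fourier g \<xi> * complex_of_real (gaussian (t n *\<^sub>R \<xi>)))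
        \<le> norm (fourier g \<xi>)" for n
      by (auto simp: norm_mult less_imp_le[OF gaussian_bounds(1)] intro!: mult_right_le_one_le gaussian_bounds(2))
  qed (use int' in auto)
  moreover have "(\<lambda>n. LINT z|lborel. g (x + t n *\<^sub>R z) * complex_of_real (gaussian z))
      \<longlonglongrightarrow> (LINT z|lborel. g x * complex_of_real (gaussian (z :: real^'n)))"
  proof (rule integral_dominated_convergence[where w="\<lambda>z. B * gaussian z"])
    show "integrable lborel (\<lambda>z::real^'n. B * gaussian z)"
      by (intro integrable_mult_right gaussian_integrable)
    have "(\<lambda>n. x + t n *\<^sub>R z) \<longlonglongrightarrow> x + 0 *\<^sub>R z" for z
      by (intro tendsto_intros t0)
    then have "(\<lambda>n. g (x + t n *\<^sub>R z)) \<longlonglongrightarrow> g (x + 0 *\<^sub>R z)" for z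
      by (intro continuous_on_tendsto_compose[OF cont]) auto
    then show "AE z in lborel. (\<lambda>n. g (x + t n *\<^sub>R z) * complex_of_real (gaussian z)) \<longlonglongrightarrow> g x * complex_of_real (gaussian z)"
      by (auto intro!: tendsto_intros)
    show "AE z in lborel. norm (g (x + t n *\<^sub>R z) * complex_of_real (gaussian z)) \<le> B * gaussian z" for n
      by (auto simp: norm_mult less_imp_le[OF gaussian_bounds(1)] intro!: mult_right_mono B)
  qed auto
  then have "(\<lambda>n. complex_of_real (sqrt (2 * pi) ^ CARD('n)) * (LINT z|lborel. g (x + t n *\<^sub>R z) * complex_of_real (gaussian z)))
      \<longlonglongrightarrow> complex_of_real (sqrt (2 * pi) ^ CARD('n)) * (LINT z|lborel. g x * complex_of_real (gaussian (z :: real^'n)))"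
    by (intro tendsto_mult tendsto_const)
  ultimately have "(LINT \<xi>|lborel. exp (\<i> * complex_of_real (\<xi> \<bullet> x)) * fourier g \<xi>) =
      complex_of_real (sqrt (2 * pi) ^ CARD('n)) * (LINT z|lborel. g x * complex_of_real (gaussian (z :: real^'n)))"
    unfolding fourier_gaussian_mean[OF int t] by (rule LIMSEQ_unique)
  \<comment> \<open>The total mass of the Gaussian contributes the second factor
    \<open>sqrt (2 * pi) ^ CARD('n)\<close>; the first came from its transform.\<close>
  also have "(LINT z|lborel. g x * complex_of_real (gaussian (z :: real^'n))) = g x * complex_of_real (sqrt (2 * pi) ^ CARD('n))"
    by (simp only: integral_mult_right_zero integral_complex_of_real gaussian_integral)
  also have "complex_of_real (sqrt (2 * pi) ^ CARD('n)) * (g x * complex_of_real (sqrt (2 * pi) ^ CARD('n))) =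
      complex_of_real ((sqrt (2 * pi) * sqrt (2 * pi)) ^ CARD('n)) * g x"
    by (simp only: power_mult_distrib of_real_mult of_real_power ac_simps)
  finally show ?thesis
    by simp
qed

lemma schwartz_fourier_inversion:
  fixes g :: "real^'n \<Rightarrow> complex"
  assumes g: "g \<in> schwartz_space"
  shows "(LINT \<xi>|lborel. exp (\<i> * complex_of_real (\<xi> \<bullet> x)) * fourier g \<xi>) = complex_of_real ((2 * pi) ^ CARD('n)) * g x"
proof (rule fourier_inversion[OF schwartz_integrable[OF g] schwartz_fourier_integrable[OF g]])
  show "continuous_on UNIV g"
    using g by (simp add: schwartz_space_def smooth_continuous)
  \<comment> \<open>Boundedness of \<open>g\<close> is the Schwartz condition with exponent zero and
    no derivatives.\<close>
  have "bounded (range (\<lambda>x. complex_of_real (monomial (\<lambda>_. 0) x) * iter_partial [] g x))"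
    using g unfolding schwartz_space_def by blast
  then show "bounded (range g)"
    by (simp add: monomial_def)
qed

subsection \<open>The weighted transform\<close>

text \<open>The determinant is a polynomial in directional derivatives along the axes, which are
  continuous.\<close>

lemma smooth_det_measurable:
  fixes \<phi> :: "real^'n \<Rightarrow> real^'n"
  assumes "smooth \<phi>"
  shows "(\<lambda>x. \<bar>det (matrix (frechet_derivative \<phi> (at x)))\<bar>) \<in> borel_measurable borel"
proof (rule borel_measurable_continuous_onI)
  have "continuous_on UNIV (\<lambda>x. frechet_derivative \<phi> (at x) v)" for v
    using assms by (intro smooth_continuous smooth_frechet_derivative)
  then show "continuous_on UNIV (\<lambda>x. \<bar>det (matrix (frechet_derivative \<phi> (at x)))\<bar>)"
    unfolding det_def matrix_def by (auto intro!: continuous_intros)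
qed

lemma weighted_fourier_eq_fourier:
  fixes \<phi> :: "real^'n \<Rightarrow> real^'n"
  assumes phi: "smooth_diffeo \<phi>" and f: "f \<in> weighted_schwartz_space \<phi> \<omega>"
  shows "weighted_fourier \<phi> \<omega> f \<xi> =
    1 / complex_of_real ((2 * pi) powr (real CARD('n) / 2)) * fourier ((\<lambda>x. \<omega> x * f x) \<circ> inv \<phi>) \<xi>"
proof -
  define g where "g = (\<lambda>x. \<omega> x * f x) \<circ> inv \<phi>"
  have bij: "bij \<phi>" and smooth: "smooth \<phi>"
    using phi by (auto simp: smooth_diffeo_def)
  have g_phi: "g (\<phi> x) = \<omega> x * f x" for x
    using bij by (simp add: g_def bij_is_inj)
  have [measurable]: "g \<in> borel_measurable borel"
    using f by (intro schwartz_measurable) (simp add: weighted_schwartz_space_def g_def)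
  have [measurable]: "\<phi> \<in> borel_measurable borel"
    using smooth by (intro borel_measurable_continuous_onI smooth_continuous)
  have J: "\<bar>jacobian_det \<phi> x\<bar> = \<bar>det (matrix (frechet_derivative \<phi> (at x)))\<bar>" for x
    by (simp add: jacobian_det_def jacobian_def)
  have [measurable]: "(\<lambda>x. \<bar>jacobian_det \<phi> x\<bar>) \<in> borel_measurable borel"
    unfolding J by (rule smooth_det_measurable[OF smooth])
  \<comment> \<open>The substitution \<open>y = \<phi> x\<close> is made by rewriting Lebesgue
    measure as the image under \<phi> of the measure with density the Jacobian.\<close>
  have "fourier g \<xi> = (LINT y|distr (density lborel (\<lambda>x. ennreal \<bar>jacobian_det \<phi> x\<bar>)) borel \<phi>.
      exp (- (\<i> * complex_of_real (\<xi> \<bullet> y))) * g y)"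
    unfolding fourier_def J
    by (subst lborel_eq_distr_density_det[OF smooth_has_derivative[OF smooth] bij smooth_det_measurable[OF smooth]]) simp
  also have "\<dots> = (LINT x|lborel. \<bar>jacobian_det \<phi> x\<bar> *\<^sub>R (exp (- (\<i> * complex_of_real (\<xi> \<bullet> \<phi> x))) * g (\<phi> x)))"
    by (subst integral_distr, measurable, subst integral_density) auto
  also have "\<dots> = (LINT x|lborel. exp (- (\<i> * complex_of_real (\<xi> \<bullet> \<phi> x))) * \<omega> x * f x * complex_of_real \<bar>jacobian_det \<phi> x\<bar>)"
    by (intro Bochner_Integration.integral_cong) (simp_all add: g_phi scaleR_conv_of_real ac_simps)
  finally show ?thesis
    by (simp add: weighted_fourier_def g_def)
qed

theorem theorem3p3:
  fixes \<phi> :: "real ^ 'n \<Rightarrow> real ^ 'n" and \<omega> f :: "real ^ 'n \<Rightarrow> complex" and x :: "real ^ 'n"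
  assumes "smooth_diffeo \<phi>"
    and "\<And>y. \<bar>jacobian_det \<phi> y\<bar> \<noteq> 0"
    and "smooth \<omega>"
    and "\<And>y. \<omega> y \<noteq> 0"
    and "f \<in> weighted_schwartz_space \<phi> \<omega>"
  shows "f x =
    1 / (\<omega> x * complex_of_real ((2 * pi) powr (real CARD('n) / 2))) *
    (LINT \<xi>|lborel. exp (\<i> * complex_of_real (\<xi> \<bullet> \<phi> x)) * weighted_fourier \<phi> \<omega> f \<xi>)"
proof -
  define g where "g = (\<lambda>x. \<omega> x * f x) \<circ> inv \<phi>"
  define c where "c = complex_of_real ((2 * pi) powr (real CARD('n) / 2))"
  have g_phi: "g (\<phi> x) = \<omega> x * f x"
    using assms(1) by (simp add: g_def smooth_diffeo_def bij_is_inj)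
  have c0: "c \<noteq> 0" by (simp add: c_def)
  \<comment> \<open>One factor \<open>c\<close> is cancelled by the normalisation inside
    \<open>weighted_fourier\<close>, the other by the constant in front of the inversion
    integral.\<close>
  have "(2 * pi) powr (real CARD('n) / 2) * (2 * pi) powr (real CARD('n) / 2) = (2 * pi) ^ CARD('n)"
    by (simp add: powr_realpow flip: powr_add)
  then have cc: "complex_of_real ((2 * pi) ^ CARD('n)) = c * c"
    by (simp add: c_def flip: of_real_mult)
  have "(LINT \<xi>|lborel. exp (\<i> * complex_of_real (\<xi> \<bullet> \<phi> x)) * weighted_fourier \<phi> \<omega> f \<xi>) =
      (LINT \<xi>|lborel. exp (\<i> * complex_of_real (\<xi> \<bullet> \<phi> x)) * fourier g \<xi>) / c"
    by (simp add: weighted_fourier_eq_fourier[OF assms(1,5)] flip: g_def c_def)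
  also have "(LINT \<xi>|lborel. exp (\<i> * complex_of_real (\<xi> \<bullet> \<phi> x)) * fourier g \<xi>) = c * c * (\<omega> x * f x)"
    using assms(5) schwartz_fourier_inversion[of g "\<phi> x"]
    unfolding cc g_phi by (simp add: weighted_schwartz_space_def flip: g_def)
  finally show ?thesis
    using assms(4)[of x] c0 by (simp flip: c_def)
qed

end
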